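(* Any randomized one-pass streaming algorithm that, for every permutation $\pi$ of $[n]$, computes $\operatorname{sgn}(\pi)$ with error probability at most $1/3$ requires $\Omega(n)$ bits of space. More generally, for every $p\ge 1$, any randomized $p$-pass streaming algorithm that computes $\operatorname{sgn}(\pi)$ with error probability at most $1/3$ on every permutation $\pi$ of $[n]$ requires $\Omega(n/p)$ bits of space. That is, there are absolute constants $c>0$ and $n_0$ such that for all $n\ge n_0$ and all $p\ge 1$, every such $p$-pass algorithm with $s$ bits of space satisfies $s\ge c\,n/p$.
   Context: $[n]=\{1,\dots,n\}$. For a permutation $\pi=(\pi_1,\dots,\pi_n)$ of $[n]$, $\operatorname{inv}(\pi)=|\{(i,j): i<j,\ \pi_i>\pi_j\}|$ and $\operatorname{sgn}(\pi)=(-1)^{\operatorname{inv}(\pi)}$. Streaming model: the input is promised to be a permutation of $[n]$, with $n$ known in advance, and the values $\pi_1,\pi_2,\dots,\pi_n$ are read in this order; in a $p$-pass algorithm this whole sequence is read $p$ times in succession, so that $x_1,\dots,x_{pn}$ with $x_{kn+i}=\pi_i$ is read. A randomized streaming algorithm using $s$ bits of space (for given $n$ and $p$) consists of a state set $\mathcal{Q}$ with $|\mathcal{Q}|\le 2^s$, an initial state $q_0$, random coins $(\rho_1,\dots,\rho_{pn},\rho_{\mathrm{out}})$ whose joint distribution is arbitrary but independent of the input (random coins are not charged as space), an update rule $q_t=\delta(q_{t-1},x_t,\rho_t)$, and an output that is a function of $q_{pn}$ and $\rho_{\mathrm{out}}$. Error at most $1/3$ means that for every input permutation, the probability over the coins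 that the output differs from $\operatorname{sgn}(\pi)$ is at most $1/3$. *)

theory Defs
  imports "HOL-Probability.Probability" "HOL-Combinatorics.Permutations"
begin

definition inversions :: "nat \<Rightarrow> (nat \<Rightarrow> nat) \<Rightarrow> (nat \<times> nat) set" where
  "inversions n \<pi> = {(i, j). i \<in> {1..n} \<and> j \<in> {1..n} \<and> i < j \<and> \<pi> i > \<pi> j}"

definition perm_sgn :: "nat \<Rightarrow> (nat \<Rightarrow> nat) \<Rightarrow> int" where
  "perm_sgn n \<pi> = (- 1) ^ card (inversions n \<pi>)"

text \<open>
  The letter read at time t, counted from 1, when the word of the permutation is read
  over and over: at time k * n + i with i in {1..n} it is the i-th value.
\<close>

definition input_stream :: "nat \<Rightarrow> (nat \<Rightarrow> nat) \<Rightarrow> nat \<Rightarrow> nat" where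
  "input_stream n \<pi> t = \<pi> (Suc ((t - 1) mod n))"

text \<open>
  The field coins is the joint distribution of all the coins. A sample is a pair consisting of
  the update coins, of which only the entries 1, ..., p * n are used, and the output coin.
  The sigma-algebra is left arbitrary, and the coins need not be independent of each other.
\<close>

record ('q, 'r, 'o) streaming_alg =
  states :: "'q set"
  initial :: 'q
  coins :: "((nat \<Rightarrow> 'r) \<times> 'o) measure"
  update :: "'q \<Rightarrow> nat \<Rightarrow> 'r \<Rightarrow> 'q"
  result :: "'q \<Rightarrow> 'o \<Rightarrow> int"

definition streaming_alg_with_space ::
    "nat \<Rightarrow> nat \<Rightarrow> ('q, 'r, 'o) streaming_alg \<Rightarrow> bool" where
  "streaming_alg_with_space n s A \<longleftrightarrow>
     finite (states A) \<and> card (states A) \<le> 2 ^ s \<and>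
     initial A \<in> states A \<and>
     prob_space (coins A) \<and>
     (\<forall>q\<in>states A. \<forall>x\<in>{1..n}. \<forall>r. update A q x r \<in> states A)"

primrec state_at ::
    "('q, 'r, 'o) streaming_alg \<Rightarrow> (nat \<Rightarrow> nat) \<Rightarrow> (nat \<Rightarrow> 'r) \<Rightarrow> nat \<Rightarrow> 'q" where
  "state_at A x \<rho> 0 = initial A"
| "state_at A x \<rho> (Suc t) = update A (state_at A x \<rho> t) (x (Suc t)) (\<rho> (Suc t))"

definition run_result ::
    "nat \<Rightarrow> nat \<Rightarrow> ('q, 'r, 'o) streaming_alg \<Rightarrow> (nat \<Rightarrow> nat) \<Rightarrow> (nat \<Rightarrow> 'r) \<times> 'o \<Rightarrow> int" where
  "run_result n p A \<pi> \<omega> =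
     result A (state_at A (input_stream n \<pi>) (fst \<omega>) (p * n)) (snd \<omega>)"

definition error_event ::
    "nat \<Rightarrow> nat \<Rightarrow> ('q, 'r, 'o) streaming_alg \<Rightarrow> (nat \<Rightarrow> nat) \<Rightarrow> ((nat \<Rightarrow> 'r) \<times> 'o) set" where
  "error_event n p A \<pi> = {\<omega> \<in> space (coins A). run_result n p A \<pi> \<omega> \<noteq> perm_sgn n \<pi>}"

text \<open>
  The error probability only makes sense if the error events are measurable (the value of
  measure on other sets is 0). This is the only measurability condition; it holds in
  particular whenever the update and the output rules are measurable.
\<close>

definition computes_perm_sgn ::
    "nat \<Rightarrow> nat \<Rightarrow> ('q, 'r, 'o) streaming_alg \<Rightarrow> bool" where
  "computes_perm_sgn n p A \<longleftrightarrow>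
     (\<forall>\<pi>. \<pi> permutes {1..n} \<longrightarrow>
        error_event n p A \<pi> \<in> sets (coins A) \<and>
        measure (coins A) (error_event n p A \<pi>) \<le> 1 / 3)"

text \<open>
  The type argument fixes the types of states and coins. It is explicit so that one can say
  that the constants do not depend on these types: an existential statement about the constants
  that is polymorphic in them would allow a different choice for every instance.
\<close>

definition perm_sgn_space_bound ::
    "('q, 'r, 'o) streaming_alg itself \<Rightarrow> real \<Rightarrow> nat \<Rightarrow> bool" where
  "perm_sgn_space_bound T c n0 \<longleftrightarrow>
     (\<forall>n\<ge>n0. \<forall>p\<ge>1. \<forall>s. \<forall>A :: ('q, 'r, 'o) streaming_alg.
        streaming_alg_with_space n s A \<and> computes_perm_sgn n p A \<longrightarrow>
        real s \<ge> c * real n / real p)"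

end

theory Submission
  imports Defs
begin

text \<open>
  Lower bound. Cut the word of the permutation into three segments of length N, with n = 3 * N up to
  a fixed tail, and let the i-th entries of the three segments permute the i-th block of three
  consecutive values. Up to a constant factor the sign is then a product of N Levi-Civita symbols,
  and each segment shows only one of the three coordinates x, y, z. (Two segments are not enough:
  each of two readers knows the set of values of the other, so few bits suffice.) A run visits
  3 * p segment ends, so it partitions the inputs into at most 2 ^ (s * (3 * p + 1)) boxes
  with a constant output. On every box the signs almost cancel: Cauchy-Schwarz in z reduces this to
  the quadratic form of the N-th tensor power of 1 - P at u tensor v, where P swaps x and y. Now
  1 - P is at most (6/5) - (4/5) P as an operator, and at product vectors P can be replaced by its
  partial transpose, which turns (6/5) - (4/5) P into 6/5 times a reflection. So the squared sum
  over a box is at most (3 * (6/5) * 9) ^ N = (162/5) ^ N, while there are 6 ^ N inputs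
  and 162/5 < 36.

  Transfer to arbitrary types of states and coins. Only the set of inputs on which a sample errs
  matters. There are finitely many such sets, so the coins can be replaced by one representative
  for each of them; finitely many states and coin values then occur, and these embed into the naturals.
\<close>

section \<open>Correlation of the Levi-Civita tensor with boxes\<close>

text \<open>A repeated coordinate gives 0, so sums against this symbol may run over all triples of
  words: only those whose coordinates form permutations contribute.\<close>

definition levi_civita :: "nat \<Rightarrow> nat \<Rightarrow> nat \<Rightarrow> real" where
  "levi_civita a b c = sgn (real b - real a) * sgn (real c - real a) * sgn (real c - real b)"

lemma sum_PiE2:
  fixes f :: "'i \<Rightarrow> 'a \<Rightarrow> 'b \<Rightarrow> 'c::comm_semiring_1"
  assumes "finite I" "finite A" "finite B"
  shows "(\<Sum>x\<in>I \<rightarrow>\<^sub>E A. \<Sum>y\<in>I \<rightarrow>\<^sub>E B. \<Prod>i\<in>I. f i (x i) (y i))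
       = (\<Prod>i\<in>I. \<Sum>a\<in>A. \<Sum>b\<in>B. f i a b)"
  using assms by (simp add: sum_distrib_left prod_sum_PiE)

text \<open>The hypotheses make R orthogonal, so G = R F has the same norm as F. Expanding the
  squared norm of F - G then gives the bound.\<close>

lemma quadratic_form_involution_le:
  fixes R :: "'a \<Rightarrow> 'a \<Rightarrow> real"
  assumes fin: "finite S"
    and sym: "\<And>a b. a \<in> S \<Longrightarrow> b \<in> S \<Longrightarrow> R a b = R b a"
    and inv: "\<And>a c. a \<in> S \<Longrightarrow> c \<in> S \<Longrightarrow> (\<Sum>b\<in>S. R a b * R b c) = of_bool (a = c)"
  shows "(\<Sum>a\<in>S. \<Sum>b\<in>S. F a * F b * R a b) \<le> (\<Sum>a\<in>S. (F a)\<^sup>2)"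
proof -
  define G where "G a = (\<Sum>b\<in>S. R a b * F b)" for a
  have "(\<Sum>a\<in>S. (G a)\<^sup>2) = (\<Sum>a\<in>S. \<Sum>b\<in>S. \<Sum>c\<in>S. R a b * F b * (R a c * F c))"
    by (simp add: G_def power2_eq_square sum_product)
  also have "\<dots> = (\<Sum>b\<in>S. \<Sum>c\<in>S. \<Sum>a\<in>S. R a b * F b * (R a c * F c))"
    by (subst sum.swap, rule sum.cong[OF refl], rule sum.swap)
  also have "\<dots> = (\<Sum>b\<in>S. \<Sum>c\<in>S. F b * F c * (\<Sum>a\<in>S. R b a * R a c))"
    by (intro sum.cong refl) (auto simp: sum_distrib_left sym mult_ac intro!: sum.cong)
  also have "\<dots> = (\<Sum>b\<in>S. \<Sum>c\<in>S. F b * F c * of_bool (b = c))"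
    by (intro sum.cong refl) (simp add: inv)
  also have "\<dots> = (\<Sum>a\<in>S. (F a)\<^sup>2)"
    using fin by (simp add: of_bool_def if_distrib power2_eq_square cong: if_cong)
  finally have GF: "(\<Sum>a\<in>S. (G a)\<^sup>2) = (\<Sum>a\<in>S. (F a)\<^sup>2)" .
  have FG: "(\<Sum>a\<in>S. \<Sum>b\<in>S. F a * F b * R a b) = (\<Sum>a\<in>S. F a * G a)"
    by (simp add: G_def sum_distrib_left mult_ac)
  have "0 \<le> (\<Sum>a\<in>S. (F a - G a)\<^sup>2)" by (simp add: sum_nonneg)
  also have "\<dots> = (\<Sum>a\<in>S. (F a)\<^sup>2) + (\<Sum>a\<in>S. (G a)\<^sup>2) - 2 * (\<Sum>a\<in>S. F a * G a)"
    by (simp add: power2_diff sum.distrib sum_subtractf sum_distrib_left mult_ac)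
  finally show ?thesis using GF FG by linarith
qed

text \<open>
  The indices z >= 3 form, with the weights below, 2/5 times the projection onto the
  symmetric tensors: contracting over all nine indices gives
  (1 - P) + (1/5) (1 + P) = (6/5) - (4/5) P.
\<close>

definition sym_ext :: "nat \<Rightarrow> nat \<Rightarrow> nat \<Rightarrow> real" where
  "sym_ext a b z =
     (if z < 3 then levi_civita a b z
      else if z < 6 then of_bool (a = z - 3 \<and> b = z - 3)
      else of_bool (a \<noteq> b \<and> a \<noteq> z - 6 \<and> b \<noteq> z - 6))"

definition ext_weight :: "nat \<Rightarrow> real" where
  "ext_weight z = (if z < 3 then 1 else if z < 6 then 2 / 5 else 1 / 5)"

lemma less_3_cases: "a < 3 \<Longrightarrow> a = 0 \<or> a = 1 \<or> a = (2::nat)"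
  by linarith

lemma sum_lessThan_3: "(\<Sum>z<3. h z) = h 0 + h 1 + h (2::nat)"
  by (simp add: eval_nat_numeral)

lemma sum_lessThan_9:
  "(\<Sum>z<9. h z) = h 0 + h 1 + h 2 + h 3 + h 4 + h 5 + h 6 + h 7 + h (8::nat)"
  by (simp add: eval_nat_numeral)

lemma sym_ext_contraction:
  assumes "a < 3" "b < 3" "a' < 3" "b' < 3"
  shows "(\<Sum>z<9. ext_weight z * (sym_ext a b z * sym_ext a' b' z))
       = 6 / 5 * of_bool (a = a' \<and> b = b') - 4 / 5 * of_bool (a = b' \<and> b = a')"
  unfolding sum_lessThan_9
  using assms[THEN less_3_cases]
  by (elim disjE; simp add: ext_weight_def sym_ext_def levi_civita_def)

text \<open>
  5/6 of the contraction after exchanging b and b' (the partial transpose).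
\<close>

definition reflection_kernel :: "nat \<Rightarrow> nat \<Rightarrow> nat \<Rightarrow> nat \<Rightarrow> real" where
  "reflection_kernel a b a' b' =
     of_bool (a = a' \<and> b = b') - 2 / 3 * of_bool (a = b \<and> a' = b')"

text \<open>The matrix J with entries \<open>of_bool (a = b \<and> a' = b')\<close> satisfies J * J
  = 3 * J, so 1 - (2/3) J squares to 1. The values of \<open>ext_weight\<close> are chosen to
  produce this ratio 2/3.\<close>

lemma reflection_kernel_involution:
  assumes "a < 3" "b < 3" "a'' < 3" "b'' < 3"
  shows "(\<Sum>a'<3. \<Sum>b'<3. reflection_kernel a b a' b' * reflection_kernel a' b' a'' b'')
       = of_bool (a = a'' \<and> b = b'')"
  unfolding sum_lessThan_3
  using assms[THEN less_3_cases]
  by (elim disjE; simp add: reflection_kernel_def)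

abbreviation ternary :: "nat \<Rightarrow> (nat \<Rightarrow> nat) set" where
  "ternary N \<equiv> {..<N} \<rightarrow>\<^sub>E {..<3}"

lemma finite_ternary: "finite (ternary N)"
  by (simp add: finite_PiE)

lemma card_ternary: "card (ternary N) = 3 ^ N"
  by (simp add: card_PiE)

text \<open>Only the names of y and y' are exchanged. For a kernel paired with a product of
  functions of single words this carries out the partial transpose.\<close>

lemma sum_swap_middle:
  "(\<Sum>x\<in>A. \<Sum>y\<in>B. \<Sum>x'\<in>A. \<Sum>y'\<in>B. f x y x' y')
   = (\<Sum>x\<in>A. \<Sum>y\<in>B. \<Sum>x'\<in>A. \<Sum>y'\<in>B. f x y' x' y)"
proof (rule sum.cong[OF refl])
  fix x
  have "(\<Sum>y\<in>B. \<Sum>x'\<in>A. \<Sum>y'\<in>B. f x y x' y') = (\<Sum>x'\<in>A. \<Sum>y\<in>B. \<Sum>y'\<in>B. f x y x' y')"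
    by (rule sum.swap)
  also have "\<dots> = (\<Sum>x'\<in>A. \<Sum>y'\<in>B. \<Sum>y\<in>B. f x y x' y')"
    by (rule sum.cong[OF refl], rule sum.swap)
  also have "\<dots> = (\<Sum>y\<in>B. \<Sum>x'\<in>A. \<Sum>y'\<in>B. f x y' x' y)"
    by (rule sum.swap)
  finally show "(\<Sum>y\<in>B. \<Sum>x'\<in>A. \<Sum>y'\<in>B. f x y x' y')
      = (\<Sum>y\<in>B. \<Sum>x'\<in>A. \<Sum>y'\<in>B. f x y' x' y)" .
qed

text \<open>A tensor power of a symmetric involution is again a symmetric involution, so the norm
  bound loses no factor depending on \<open>N\<close>.\<close>

lemma prod_reflection_form_le:
  "(\<Sum>x\<in>ternary N. \<Sum>y\<in>ternary N. \<Sum>x'\<in>ternary N. \<Sum>y'\<in>ternary N.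
      F x y * F x' y' * (\<Prod>i<N. reflection_kernel (x i) (y i) (x' i) (y' i)))
   \<le> (\<Sum>x\<in>ternary N. \<Sum>y\<in>ternary N. (F x y)\<^sup>2)"
proof -
  let ?X = "ternary N"
  define R where "R = (\<lambda>(x, y) (x', y'). \<Prod>i<N. reflection_kernel (x i) (y i) (x' i) (y' i))"
  have "(\<Sum>a\<in>?X\<times>?X. \<Sum>b\<in>?X\<times>?X. case_prod F a * case_prod F b * R a b)
      \<le> (\<Sum>a\<in>?X\<times>?X. (case_prod F a)\<^sup>2)"
  proof (rule quadratic_form_involution_le)
    show "finite (?X \<times> ?X)" by (simp add: finite_ternary)
    show "R a b = R b a" for a b
      by (auto simp: R_def reflection_kernel_def split: prod.split intro!: prod.cong)
    fix a c assume ac: "a \<in> ?X \<times> ?X" "c \<in> ?X \<times> ?X"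
    obtain x y where a: "a = (x, y)" "x \<in> ?X" "y \<in> ?X" using ac by auto
    obtain x'' y'' where c: "c = (x'', y'')" "x'' \<in> ?X" "y'' \<in> ?X" using ac by auto
    have lt: "x i < 3" "y i < 3" "x'' i < 3" "y'' i < 3" if "i < N" for i
      using a c that by auto
    have "(\<Sum>b\<in>?X\<times>?X. R a b * R b c) = (\<Sum>x'\<in>?X. \<Sum>y'\<in>?X. \<Prod>i<N.
         reflection_kernel (x i) (y i) (x' i) (y' i) * reflection_kernel (x' i) (y' i) (x'' i) (y'' i))"
      by (simp add: sum.cartesian_product' R_def a c prod.distrib)
    also have "\<dots> = (\<Prod>i<N. of_bool (x i = x'' i \<and> y i = y'' i))"
      by (subst sum_PiE2) (auto simp: lt reflection_kernel_involution intro!: prod.cong)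
    also have "\<dots> = of_bool (\<forall>i<N. x i = x'' i \<and> y i = y'' i)"
      by (induction N) (auto simp: less_Suc_eq)
    also have "(\<forall>i<N. x i = x'' i \<and> y i = y'' i) \<longleftrightarrow> a = c"
    proof
      assume eq: "\<forall>i<N. x i = x'' i \<and> y i = y'' i"
      have "x = x''" by (rule PiE_ext[OF a(2) c(2)]) (use eq in auto)
      moreover have "y = y''" by (rule PiE_ext[OF a(3) c(3)]) (use eq in auto)
      ultimately show "a = c" using a c by simp
    qed (use a c in simp)
    finally show "(\<Sum>b\<in>?X\<times>?X. R a b * R b c) = of_bool (a = c)" .
  qed
  then show ?thesis
    by (simp add: sum.cartesian_product' R_def)
qed

text \<open>The trivial bound is 36 ^ N, the square of the total mass of the tensor; a constant
  factor per coordinate is saved. Real weights instead of indicators allow the output value on a box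
  to be absorbed into one of them.\<close>

lemma levi_civita_discrepancy:
  fixes u v w :: "(nat \<Rightarrow> nat) \<Rightarrow> real"
  assumes u: "\<And>x. \<bar>u x\<bar> \<le> 1" and v: "\<And>x. \<bar>v x\<bar> \<le> 1" and w: "\<And>x. \<bar>w x\<bar> \<le> 1"
  shows "(\<Sum>x\<in>ternary N. \<Sum>y\<in>ternary N. \<Sum>z\<in>ternary N.
            (\<Prod>i<N. levi_civita (x i) (y i) (z i)) * (u x * v y * w z))\<^sup>2 \<le> (162 / 5) ^ N"
    (is "?S\<^sup>2 \<le> _")
proof -
  let ?X = "ternary N"
  let ?Z = "{..<N} \<rightarrow>\<^sub>E {..<9::nat}"
  define E where "E z x y = (\<Prod>i<N. sym_ext (x i) (y i) (z i))" for x y z :: "nat \<Rightarrow> nat"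
  define a where "a z = (\<Sum>x\<in>?X. \<Sum>y\<in>?X. E z x y * (u x * v y))" for z
  define C where "C z = (\<Prod>i<N. ext_weight (z i))" for z
  have finZ: "finite ?Z" by (simp add: finite_PiE)
  have XZ: "?X \<subseteq> ?Z" by (intro PiE_mono) auto
  have zlt: "z i < 3" if "z \<in> ?X" "i < N" for z i
    using PiE_mem[OF that(1)] that(2) by simp
  have EX: "E z x y = (\<Prod>i<N. levi_civita (x i) (y i) (z i))" if "z \<in> ?X" for x y z
    unfolding E_def using zlt[OF that] by (simp add: sym_ext_def)
  have CX: "C z = 1" if "z \<in> ?X" for z
    unfolding C_def using zlt[OF that] by (simp add: ext_weight_def)
  have Cnn: "0 \<le> C z" for z unfolding C_def by (rule prod_nonneg) (simp add: ext_weight_def)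
  have "?S = (\<Sum>x\<in>?X. \<Sum>z\<in>?X. \<Sum>y\<in>?X. E z x y * (u x * v y * w z))"
    by (rule sum.cong[OF refl], rule trans[OF sum.swap]) (simp add: EX mult_ac)
  also have "\<dots> = (\<Sum>z\<in>?X. w z * a z)"
    by (subst sum.swap) (simp add: a_def sum_distrib_left mult_ac)
  finally have "?S\<^sup>2 = (\<Sum>z\<in>?X. w z * a z)\<^sup>2" by simp
  also have "\<dots> \<le> (\<Sum>z\<in>?X. (w z)\<^sup>2) * (\<Sum>z\<in>?X. (a z)\<^sup>2)"
    by (rule Cauchy_Schwarz_ineq_sum)
  also have "\<dots> \<le> 3 ^ N * (\<Sum>z\<in>?X. (a z)\<^sup>2)"
  proof (intro mult_right_mono sum_nonneg)
    have "(\<Sum>z\<in>?X. (w z)\<^sup>2) \<le> (\<Sum>z\<in>?X. 1)"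
      by (intro sum_mono) (simp add: w abs_square_le_1)
    then show "(\<Sum>z\<in>?X. (w z)\<^sup>2) \<le> 3 ^ N" by (simp add: card_ternary)
  qed auto
  also have "(\<Sum>z\<in>?X. (a z)\<^sup>2) = (\<Sum>z\<in>?X. C z * (a z)\<^sup>2)"
    by (simp add: CX)
  \<comment> \<open>Enlarging the alphabet of z from 3 to 9 letters only adds nonnegative terms.
    This realises the operator inequality between 1 - P and (6/5) - (4/5) P.\<close>
  also have "\<dots> \<le> (\<Sum>z\<in>?Z. C z * (a z)\<^sup>2)"
    using XZ finZ Cnn by (intro sum_mono2) auto
  also have "\<dots> = (\<Sum>z\<in>?Z. \<Sum>x\<in>?X. \<Sum>y\<in>?X. \<Sum>x'\<in>?X. \<Sum>y'\<in>?X.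
      (u x * v y) * (u x' * v y') * (C z * (E z x y * E z x' y')))"
    unfolding a_def power2_eq_square sum_distrib_right unfolding sum_distrib_left
    by (intro sum.cong[OF refl]) (simp only: mult_ac)
  also have "\<dots> = (\<Sum>x\<in>?X. \<Sum>y\<in>?X. \<Sum>x'\<in>?X. \<Sum>y'\<in>?X. \<Sum>z\<in>?Z.
      (u x * v y) * (u x' * v y') * (C z * (E z x y * E z x' y')))"
    by (rule trans[OF sum.swap], rule sum.cong[OF refl], rule trans[OF sum.swap],
        rule sum.cong[OF refl], rule trans[OF sum.swap], rule sum.cong[OF refl], rule sum.swap)
  also have "\<dots> = (\<Sum>x\<in>?X. \<Sum>y\<in>?X. \<Sum>x'\<in>?X. \<Sum>y'\<in>?X. (u x * v y) * (u x' * v y') *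
      (\<Prod>i<N. 6 / 5 * of_bool (x i = x' i \<and> y i = y' i) - 4 / 5 * of_bool (x i = y' i \<and> y i = x' i)))"
  proof (intro sum.cong[OF refl])
    fix x y x' y' assume "x \<in> ?X" "y \<in> ?X" "x' \<in> ?X" "y' \<in> ?X"
    then have lt: "x i < 3" "y i < 3" "x' i < 3" "y' i < 3" if "i < N" for i
      using that by auto
    have "(\<Sum>z\<in>?Z. C z * (E z x y * E z x' y'))
        = (\<Prod>i<N. \<Sum>z<9. ext_weight z * (sym_ext (x i) (y i) z * sym_ext (x' i) (y' i) z))"
      by (simp add: prod_sum_PiE C_def E_def prod.distrib)
    also have "\<dots> = (\<Prod>i<N. 6 / 5 * of_bool (x i = x' i \<and> y i = y' i) - 4 / 5 * of_bool (x i = y' i \<and> y i = x' i))"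
      by (intro prod.cong[OF refl] sym_ext_contraction) (auto simp: lt)
    finally show "(\<Sum>z\<in>?Z. (u x * v y) * (u x' * v y') * (C z * (E z x y * E z x' y')))
      = (u x * v y) * (u x' * v y') *
      (\<Prod>i<N. 6 / 5 * of_bool (x i = x' i \<and> y i = y' i) - 4 / 5 * of_bool (x i = y' i \<and> y i = x' i))"
      by (simp flip: sum_distrib_left)
  qed
  \<comment> \<open>The weight is a product of four one-word factors, so exchanging y and y' merely
    permutes them, while P in the kernel becomes its partial transpose.\<close>
  also have "\<dots> = (\<Sum>x\<in>?X. \<Sum>y\<in>?X. \<Sum>x'\<in>?X. \<Sum>y'\<in>?X. (u x * v y') * (u x' * v y) *
      (\<Prod>i<N. 6 / 5 * of_bool (x i = x' i \<and> y' i = y i) - 4 / 5 * of_bool (x i = y i \<and> y' i = x' i)))"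
    by (rule sum_swap_middle)
  also have "\<dots> = (\<Sum>x\<in>?X. \<Sum>y\<in>?X. \<Sum>x'\<in>?X. \<Sum>y'\<in>?X. (6 / 5) ^ N * ((u x * v y) * (u x' * v y') *
      (\<Prod>i<N. reflection_kernel (x i) (y i) (x' i) (y' i))))"
  proof (intro sum.cong[OF refl])
    fix x y x' y' :: "nat \<Rightarrow> nat"
    have "(\<Prod>i<N. 6 / 5 * of_bool (x i = x' i \<and> y' i = y i) - 4 / 5 * of_bool (x i = y i \<and> y' i = x' i))
       = (\<Prod>i<N. (6 / 5) * reflection_kernel (x i) (y i) (x' i) (y' i))"
      by (intro prod.cong[OF refl]) (auto simp: reflection_kernel_def)
    then show "(u x * v y') * (u x' * v y) * (\<Prod>i<N. 6 / 5 * of_bool (x i = x' i \<and> y' i = y i)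
        - 4 / 5 * of_bool (x i = y i \<and> y' i = x' i))
      = (6 / 5) ^ N * ((u x * v y) * (u x' * v y') * (\<Prod>i<N. reflection_kernel (x i) (y i) (x' i) (y' i)))"
      by (simp only: prod.distrib) (simp add: mult_ac)
  qed
  also have "\<dots> \<le> (6 / 5) ^ N * (\<Sum>x\<in>?X. \<Sum>y\<in>?X. (u x * v y)\<^sup>2)"
    unfolding sum_distrib_left[symmetric]
    by (intro mult_left_mono prod_reflection_form_le) simp
  also have "\<dots> \<le> (6 / 5) ^ N * (\<Sum>x\<in>?X. \<Sum>y\<in>?X. 1)"
    using u v
    by (intro mult_left_mono sum_mono) (simp_all add: abs_square_le_1 abs_mult mult_le_one)
  also have "\<dots> = (6 / 5) ^ N * 9 ^ N"
    by (simp add: card_ternary flip: power_mult_distrib)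
  finally have "?S\<^sup>2 \<le> 3 ^ N * ((6 / 5) ^ N * 9 ^ N)" by simp
  also have "\<dots> = (162 / 5) ^ N" by (simp flip: power_mult_distrib)
  finally show ?thesis .
qed

section \<open>Permutations built from blocks of three values\<close>

text \<open>
  v a i is the coordinate in {0, 1, 2}, within block i, of the i-th entry of segment a; segments
  and blocks are counted from 0, positions and values from 1.
\<close>

definition block_perm :: "nat \<Rightarrow> (nat \<Rightarrow> nat \<Rightarrow> nat) \<Rightarrow> nat \<Rightarrow> nat" where
  "block_perm N v t =
     (if t \<in> {1..3 * N} then Suc (3 * ((t - 1) mod N) + v ((t - 1) div N) ((t - 1) mod N)) else t)"

definition admissible :: "nat \<Rightarrow> (nat \<Rightarrow> nat \<Rightarrow> nat) \<Rightarrow> bool" where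
  "admissible N v \<longleftrightarrow> (\<forall>i<N. inj_on (\<lambda>a. v a i) {..<3} \<and> (\<forall>a<3. v a i < 3))"

lemma position_cases:
  assumes "t \<in> {1..3 * N}"
  obtains a i where "a < 3" "i < N" "t = Suc (a * N + i)"
proof
  have "N > 0" using assms by (cases N) auto
  then show "(t - 1) div N < 3" "(t - 1) mod N < N"
    using assms by (auto simp: less_mult_imp_div_less)
  show "t = Suc ((t - 1) div N * N + (t - 1) mod N)" using assms by simp
qed

lemma position_le:
  assumes "a < 3" "i < (N::nat)"
  shows "Suc (a * N + i) \<le> 3 * N"
proof -
  have "Suc (a * N + i) \<le> Suc a * N" using assms by simp
  also have "\<dots> \<le> 3 * N" using assms by (intro mult_right_mono) auto
  finally show ?thesis .
qed

text \<open>Two-digit numbers in base \<open>N\<close> compare lexicographically. This serves for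
  positions and, with base 3 and the block index as leading digit, for values.\<close>

lemma position_less_iff:
  assumes "i < (N::nat)" "j < N"
  shows "a * N + i < b * N + j \<longleftrightarrow> a < b \<or> (a = b \<and> i < j)"
proof -
  have *: "a * N + i < b * N + j" if "a < b" "i < N" for a b i j
  proof -
    have "a * N + i < Suc a * N" using that by simp
    also have "\<dots> \<le> b * N" using that by (intro mult_right_mono) auto
    finally show ?thesis by simp
  qed
  from *[of a b i j] *[of b a j i] show ?thesis using assms
    by (cases a b rule: linorder_cases) auto
qed

lemma position_eq_iff:
  assumes "i < (N::nat)" "j < N"
  shows "a * N + i = b * N + j \<longleftrightarrow> a = b \<and> i = j"
  using position_less_iff[OF assms, of a b] position_less_iff[OF assms(2,1), of b a]
  by auto

lemma block_perm_position:
  assumes "a < 3" "i < N"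
  shows "block_perm N v (Suc (a * N + i)) = Suc (3 * i + v a i)"
  using position_le[OF assms] assms by (simp add: block_perm_def)

lemma block_perm_outside: "t \<notin> {1..3 * N} \<Longrightarrow> block_perm N v t = t"
  unfolding block_perm_def by (rule if_not_P)

lemma block_perm_inside:
  assumes "admissible N v" "t \<in> {1..3 * N}"
  shows "block_perm N v t \<in> {1..3 * N}"
proof -
  obtain a i where ai: "a < 3" "i < N" "t = Suc (a * N + i)"
    using position_cases[OF assms(2)] .
  then have "v a i < 3" using assms(1) by (simp add: admissible_def)
  then show ?thesis using ai by (simp add: block_perm_position)
qed

lemma block_perm_permutes:
  assumes adm: "admissible N v" and "3 * N \<le> n"
  shows "block_perm N v permutes {1..n}"
proof -
  have inj: "inj_on (block_perm N v) {1..3 * N}"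
  proof (rule inj_onI)
    fix t t' assume t: "t \<in> {1..3 * N}" "t' \<in> {1..3 * N}" and eq: "block_perm N v t = block_perm N v t'"
    obtain a i where ai: "a < 3" "i < N" "t = Suc (a * N + i)" using position_cases[OF t(1)] .
    obtain b j where bj: "b < 3" "j < N" "t' = Suc (b * N + j)" using position_cases[OF t(2)] .
    have v3: "v a i < 3" "v b j < 3" using ai bj adm by (simp_all add: admissible_def)
    have "i * 3 + v a i = j * 3 + v b j" using eq ai bj by (simp add: block_perm_position)
    then have "i = j \<and> v a i = v b j" using position_eq_iff[OF v3] by blast
    then have "i = j" "v a i = v b j" by blast+
    moreover have "inj_on (\<lambda>a. v a i) {..<3}" using adm ai by (simp add: admissible_def)
    ultimately have "a = b" using ai bj by (auto dest: inj_onD)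
    then show "t = t'" using \<open>i = j\<close> ai bj by simp
  qed
  moreover have "block_perm N v ` {1..3 * N} \<subseteq> {1..3 * N}"
    using block_perm_inside[OF adm] by blast
  ultimately have "bij_betw (block_perm N v) {1..3 * N} {1..3 * N}"
    by (simp add: bij_betw_def endo_inj_surj)
  then have "block_perm N v permutes {1..3 * N}"
    by (rule bij_imp_permutes) (rule block_perm_outside)
  then show ?thesis by (rule permutes_subset) (use assms(2) in auto)
qed

text \<open>
  The inversions between different blocks, which do not depend on v: ((a, b), (i, j)) stands for
  entry i of segment a and entry j of segment b.
\<close>

definition block_inversions :: "nat \<Rightarrow> ((nat \<times> nat) \<times> nat \<times> nat) set" where
  "block_inversions N = {((a, b), (i, j)). a < b \<and> b < 3 \<and> j < i \<and> i < N}"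

definition block_sign :: "nat \<Rightarrow> int" where
  "block_sign N = (-1) ^ card (block_inversions N)"

definition local_inversions :: "(nat \<Rightarrow> nat) \<Rightarrow> (nat \<times> nat) set" where
  "local_inversions u = {p \<in> {(0, 1), (0, 2), (1, 2)}. u (snd p) < u (fst p)}"

lemma levi_civita_local_inversions:
  assumes "inj_on u {..<3}"
  shows "(-1) ^ card (local_inversions u) = levi_civita (u 0) (u 1) (u 2)"
proof -
  have ne: "u 0 \<noteq> u 1" "u 0 \<noteq> u 2" "u 1 \<noteq> u 2"
    using inj_onD[OF assms, of 0 1] inj_onD[OF assms, of 0 2] inj_onD[OF assms, of 1 2] by auto
  let ?S = "{(0, 1), (0, 2), (1, 2)} :: (nat \<times> nat) set"
  have "(-1) ^ card (local_inversions u) = (\<Prod>p\<in>{p \<in> ?S. u (snd p) < u (fst p)}. - 1 :: real)"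
    by (simp only: local_inversions_def prod_constant)
  also have "\<dots> = (\<Prod>p\<in>?S. if u (snd p) < u (fst p) then - 1 else 1)"
    by (subst prod.inter_filter) auto
  also have "\<dots> = levi_civita (u 0) (u 1) (u 2)"
    using ne by (simp add: levi_civita_def sgn_if)
  finally show ?thesis .
qed

text \<open>Values in different blocks compare like the blocks, so these inversions are the same for
  every v and yield \<open>block_sign\<close>. Within a block the three coordinates alone decide,
  and the tail contributes no inversion.\<close>

lemma perm_sgn_block_perm:
  assumes adm: "admissible N v" and le: "3 * N \<le> n"
  shows "real_of_int (perm_sgn n (block_perm N v))
       = real_of_int (block_sign N) * (\<Prod>i<N. levi_civita (v 0 i) (v 1 i) (v 2 i))"
proof -
  let ?\<pi> = "block_perm N v"
  define L where "L i = local_inversions (\<lambda>a. v a i)" for i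
  \<comment> \<open>\<open>f\<close> turns segment and block indices into positions;
    \<open>g\<close> puts the local inversions of block i on the diagonal, where both entries have
    block index i.\<close>
  define f where "f = (\<lambda>((a, b), (i, j)). (Suc (a * N + i), Suc (b * N + j)))"
  define g where "g = (\<lambda>(i, (a, b)). ((a, b), (i, i)) :: (nat \<times> nat) \<times> nat \<times> nat)"
  let ?J = "SIGMA i:{..<N}. L i"
  let ?D = "{((a, b), (i, j)). a < 3 \<and> b < 3 \<and> i < N \<and> j < N}"
  have finL: "finite (L i)" for i
    unfolding L_def local_inversions_def by (rule finite_subset[of _ "{(0, 1), (0, 2), (1, 2)}"]) auto
  have L_iff: "(a, b) \<in> L i \<longleftrightarrow> a < b \<and> b < 3 \<and> v b i < v a i" for a b i
    by (auto simp: L_def local_inversions_def)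
  have v3: "v a i < 3" if "a < 3" "i < N" for a i
    using adm that by (simp add: admissible_def)
  have sub: "block_inversions N \<subseteq> ?D" "g ` ?J \<subseteq> ?D"
    by (auto simp: block_inversions_def g_def L_iff)
  have val: "block_perm N v (Suc (b * N + j)) < block_perm N v (Suc (a * N + i))
      \<longleftrightarrow> j < i \<or> (i = j \<and> v b j < v a i)" if "a < 3" "b < 3" "i < N" "j < N" for a b i j
  proof -
    have "block_perm N v (Suc (a * N + i)) = Suc (i * 3 + v a i)"
      and "block_perm N v (Suc (b * N + j)) = Suc (j * 3 + v b j)"
      using that by (simp_all add: block_perm_position)
    then show ?thesis
      using position_less_iff[OF v3[OF that(2,4)] v3[OF that(1,3)], of j i] by auto
  qed
  have "inversions n ?\<pi> = f ` (block_inversions N \<union> g ` ?J)"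
  proof (intro equalityI subsetI)
    fix q assume "q \<in> inversions n ?\<pi>"
    then obtain t t' where q: "q = (t, t')" "1 \<le> t" "t < t'" "?\<pi> t' < ?\<pi> t"
      by (auto simp: inversions_def)
    \<comment> \<open>A tail position is fixed and every earlier position carries a smaller value,
      so it cannot end an inversion.\<close>
    have t': "t' \<in> {1..3 * N}"
    proof (rule ccontr)
      assume out: "t' \<notin> {1..3 * N}"
      have "?\<pi> t \<le> t \<or> ?\<pi> t \<le> 3 * N"
        using block_perm_inside[OF adm, of t] block_perm_outside[of t N v] by force
      then show False using out q block_perm_outside[OF out, of v] by auto
    qed
    then have t: "t \<in> {1..3 * N}" using q by auto
    obtain a i where ai: "a < 3" "i < N" "t = Suc (a * N + i)" using position_cases[OF t] .
    obtain b j where bj: "b < 3" "j < N" "t' = Suc (b * N + j)" using position_cases[OF t'] .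
    have "j < i \<or> (i = j \<and> v b j < v a i)" using q ai bj val by simp
    \<comment> \<open>Together with the comparison of values this forces a < b: inside one segment
      the block index grows with the position, so a segment has no inversion.\<close>
    moreover have "a < b \<or> (a = b \<and> i < j)" using q ai bj position_less_iff by simp
    ultimately have "((a, b), (i, j)) \<in> block_inversions N \<union> g ` ?J"
      using ai bj by (force simp: block_inversions_def g_def L_iff)
    moreover have "q = f ((a, b), (i, j))" using q ai bj by (simp add: f_def)
    ultimately show "q \<in> f ` (block_inversions N \<union> g ` ?J)" by blast
  next
    fix q assume "q \<in> f ` (block_inversions N \<union> g ` ?J)"
    then obtain a b i j where q: "q = (Suc (a * N + i), Suc (b * N + j))"
      and ab: "a < b" "b < 3" and ij: "i < N" "j < N" "j < i \<or> (i = j \<and> v b j < v a i)"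
      by (auto simp: f_def g_def block_inversions_def L_iff)
    have "block_perm N v (Suc (b * N + j)) < block_perm N v (Suc (a * N + i))"
      using val[of a b i j] ab ij by simp
    moreover have "a * N + i < b * N + j" using ab ij by (simp add: position_less_iff)
    moreover have "Suc (a * N + i) \<le> n" "Suc (b * N + j) \<le> n"
      using position_le[of a i N] position_le[of b j N] ab ij le by auto
    ultimately show "q \<in> inversions n ?\<pi>"
      by (simp add: inversions_def q)
  qed
  moreover have "inj_on f (block_inversions N \<union> g ` ?J)"
  proof (rule inj_on_subset)
    show "inj_on f ?D"
      by (rule inj_onI) (auto simp: f_def position_eq_iff)
  qed (use sub in blast)
  ultimately have "card (inversions n ?\<pi>) = card (block_inversions N \<union> g ` ?J)"
    by (simp add: card_image)
  also have "\<dots> = card (block_inversions N) + card (g ` ?J)"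
  proof (rule card_Un_disjoint)
    show "finite (block_inversions N)"
      by (rule finite_subset[of _ "({..<3} \<times> {..<3}) \<times> ({..<N} \<times> {..<N})"])
         (auto simp: block_inversions_def)
    show "finite (g ` ?J)" using finL by simp
    show "block_inversions N \<inter> g ` ?J = {}" by (auto simp: block_inversions_def g_def)
  qed
  also have "card (g ` ?J) = card ?J"
    by (rule card_image) (auto simp: inj_on_def g_def)
  also have "card ?J = (\<Sum>i<N. card (L i))"
    using finL by simp
  finally have "real_of_int (perm_sgn n ?\<pi>) 
      = real_of_int (block_sign N) * (\<Prod>i<N. (-1) ^ card (L i))"
    by (simp add: perm_sgn_def block_sign_def power_add power_sum)
  also have "(\<Prod>i<N. (-1) ^ card (L i)) = (\<Prod>i<N. levi_civita (v 0 i) (v 1 i) (v 2 i))"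
    unfolding L_def using adm
    by (intro prod.cong[OF refl] levi_civita_local_inversions) (simp add: admissible_def)
  finally show ?thesis .
qed

section \<open>Simulation by natural numbers\<close>

lemma inputs_in_range:
  assumes "\<pi> permutes {1..n}" "1 \<le> t" "t \<le> p * n"
  shows "input_stream n \<pi> t \<in> {1..n}"
proof -
  have "n > 0" using assms by (cases n) auto
  then have "Suc ((t - 1) mod n) \<in> {1..n}" by (simp add: Suc_le_eq)
  then show ?thesis unfolding input_stream_def using permutes_in_image[OF assms(1)] by blast
qed

lemma state_at_in_states:
  assumes "streaming_alg_with_space n s A" "\<And>i. 1 \<le> i \<Longrightarrow> i \<le> t \<Longrightarrow> x i \<in> {1..n}"
  shows "state_at A x \<rho> t \<in> states A"
  using assms(2)
  by (induction t) (use assms(1) in \<open>auto simp: streaming_alg_with_space_def\<close>)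

lemma discrete_simulation:
  fixes A :: "('q, 'r, 'o) streaming_alg"
  assumes space: "streaming_alg_with_space n s A" and comp: "computes_perm_sgn n p A"
  shows "\<exists>B :: (nat, nat, nat) streaming_alg. streaming_alg_with_space n s B \<and> computes_perm_sgn n p B"
proof -
  define P where "P = {\<pi>. \<pi> permutes {1..n}}"
  define err where "err = error_event n p A"
  define sig where "sig \<omega> = {\<pi> \<in> P. \<omega> \<in> err \<pi>}" for \<omega>
  \<comment> \<open>For a set S that no sample attains this is an arbitrary element; only the values
    at \<open>sig \<omega>\<close> are relevant.\<close>
  define rep where "rep S = (SOME \<omega>. \<omega> \<in> space (coins A) \<and> sig \<omega> = S)" for S
  \<comment> \<open>Restricting to the times 1, ..., \<open>p * n\<close> at which update coins are
    read keeps \<open>RC\<close> finite.\<close>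
  define RC where "RC = (\<lambda>(S, t). fst (rep S) t) ` (Pow P \<times> {1..p * n})"
  define OC where "OC = (\<lambda>S. snd (rep S)) ` Pow P"
  define Q where "Q = states A"
  define code where
    "code S = (\<lambda>t. to_nat_on RC (fst (rep S) t), to_nat_on OC (snd (rep S)))" for S
  \<comment> \<open>\<open>B\<close> draws the code of a representative with the probability that
    its error set has under \<open>A\<close>. On the discrete coin space every event is
    measurable.\<close>
  define B :: "(nat, nat, nat) streaming_alg" where
    "B = \<lparr>states = to_nat_on Q ` Q, initial = to_nat_on Q (initial A),
          coins = distr (coins A) (count_space UNIV) (\<lambda>\<omega>. code (sig \<omega>)),
          update = (\<lambda>q x r. to_nat_on Q (update A (from_nat_into Q q) x (from_nat_into RC r))),
          result = (\<lambda>q c. result A (from_nat_into Q q) (from_nat_into OC c))\<rparr>"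
  interpret prob_space "coins A" using space by (simp add: streaming_alg_with_space_def)
  have finP: "finite P" unfolding P_def by (rule finite_permutations) simp
  have finQ: "finite Q" "Q \<noteq> {}" using space by (auto simp: streaming_alg_with_space_def Q_def)
  have finRC: "finite RC" and finOC: "finite OC" using finP by (auto simp: RC_def OC_def)
  have err_sets: "err \<pi> \<in> sets (coins A)" if "\<pi> \<in> P" for \<pi>
    using that comp by (auto simp: P_def err_def computes_perm_sgn_def)
  have sig_Pow: "sig \<omega> \<in> Pow P" for \<omega> by (auto simp: sig_def)
  have rep: "rep (sig \<omega>) \<in> space (coins A)" "sig (rep (sig \<omega>)) = sig \<omega>"
    if "\<omega> \<in> space (coins A)" for \<omega>
    using someI[of "\<lambda>\<omega>'. \<omega>' \<in> space (coins A) \<and> sig \<omega>' = sig \<omega>" \<omega>] that by (auto simp: rep_def)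
  \<comment> \<open>There are finitely many error sets, and the preimage of each is a Boolean
    combination of error events, whose measurability is part of
    \<open>computes_perm_sgn\<close>.\<close>
  have sig_meas: "sig \<in> measurable (coins A) (count_space (Pow P))"
  proof (subst measurable_count_space_eq2)
    show "finite (Pow P)" using finP by simp
    show "sig \<in> space (coins A) \<rightarrow> Pow P \<and> (\<forall>S\<in>Pow P. sig -` {S} \<inter> space (coins A) \<in> sets (coins A))"
    proof (intro conjI ballI)
      fix S assume "S \<in> Pow P"
      then have "sig \<omega> = S \<longleftrightarrow> (\<forall>\<pi>\<in>P. \<omega> \<in> err \<pi> \<longleftrightarrow> \<pi> \<in> S)" for \<omega>
        unfolding sig_def by blast
      then have "sig -` {S} \<inter> space (coins A)
          = {\<omega> \<in> space (coins A). \<forall>\<pi>\<in>P. \<omega> \<in> err \<pi> \<longleftrightarrow> \<pi> \<in> S}"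
        by auto
      also have "\<dots> \<in> sets (coins A)"
      proof (rule sets.sets_Collect_finite_All[OF _ finP])
        fix \<pi> assume "\<pi> \<in> P"
        have "{\<omega> \<in> space (coins A). \<omega> \<in> err \<pi> \<longleftrightarrow> \<pi> \<in> S}
            = (if \<pi> \<in> S then err \<pi> else space (coins A) - err \<pi>)"
          by (auto simp: err_def error_event_def)
        then show "{\<omega> \<in> space (coins A). \<omega> \<in> err \<pi> \<longleftrightarrow> \<pi> \<in> S} \<in> sets (coins A)"
          using err_sets[OF \<open>\<pi> \<in> P\<close>] by (simp add: sets.compl_sets)
      qed
      finally show "sig -` {S} \<inter> space (coins A) \<in> sets (coins A)" .
    qed (use sig_Pow in auto)
  qed
  have code_meas: "(\<lambda>\<omega>. code (sig \<omega>)) \<in> measurable (coins A) (count_space UNIV)"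
    using measurable_comp[OF sig_meas, of code "count_space UNIV"] by (simp add: comp_def)
  have B_space: "streaming_alg_with_space n s B"
    using space finQ code_meas unfolding streaming_alg_with_space_def
    by (auto simp: B_def Q_def[symmetric] countable_finite prob_space_distr
             intro!: imageI order_trans[OF card_image_le])
  have result_B: "run_result n p B \<pi> (code (sig \<omega>)) = run_result n p A \<pi> (rep (sig \<omega>))"
    if "\<pi> \<in> P" for \<pi> \<omega>
  proof -
    define x where "x = input_stream n \<pi>"
    have x: "x t \<in> {1..n}" if "1 \<le> t" "t \<le> p * n" for t
      using \<open>\<pi> \<in> P\<close> inputs_in_range that by (auto simp: x_def P_def)
    have "state_at B x (fst (code (sig \<omega>))) t = to_nat_on Q (state_at A x (fst (rep (sig \<omega>))) t)"
      if "t \<le> p * n" for t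
      using that
    proof (induction t)
      case (Suc t)
      have "state_at A x (fst (rep (sig \<omega>))) t \<in> Q"
        unfolding Q_def using space x Suc.prems by (intro state_at_in_states) auto
      moreover have "fst (rep (sig \<omega>)) (Suc t) \<in> RC"
        unfolding RC_def using sig_Pow Suc.prems
        by (intro image_eqI[where x = "(sig \<omega>, Suc t)"]) auto
      ultimately show ?case
        using Suc finQ finRC by (simp add: B_def code_def countable_finite)
    qed (simp add: B_def)
    moreover have "state_at A x (fst (rep (sig \<omega>))) (p * n) \<in> Q"
      unfolding Q_def using space x by (intro state_at_in_states) auto
    moreover have "snd (rep (sig \<omega>)) \<in> OC"
      using sig_Pow by (auto simp: OC_def)
    ultimately show ?thesis
      using finQ finOC by (simp add: run_result_def x_def[symmetric] B_def code_def countable_finite)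
  qed
  have "measure (coins B) (error_event n p B \<pi>) \<le> 1 / 3" if "\<pi> \<in> P" for \<pi>
  proof -
    have "measure (coins B) (error_event n p B \<pi>)
        = prob ((\<lambda>\<omega>. code (sig \<omega>)) -` error_event n p B \<pi> \<inter> space (coins A))"
      by (simp add: B_def measure_distr code_meas)
    \<comment> \<open>On the code of \<open>sig \<omega>\<close> the algorithm \<open>B\<close>
      gives the result of \<open>A\<close> on the representative, which errs on the same inputs as
      \<omega> itself.\<close>
    also have "(\<lambda>\<omega>. code (sig \<omega>)) -` error_event n p B \<pi> \<inter> space (coins A) = err \<pi>"
    proof -
      have "run_result n p A \<pi> (rep (sig \<omega>)) \<noteq> perm_sgn n \<pi> \<longleftrightarrow> \<omega> \<in> err \<pi>"
        if "\<omega> \<in> space (coins A)" for \<omega>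
      proof -
        have "\<pi> \<in> sig (rep (sig \<omega>)) \<longleftrightarrow> \<pi> \<in> sig \<omega>" using rep that by simp
        then show ?thesis using \<open>\<pi> \<in> P\<close> rep that by (simp add: sig_def err_def error_event_def)
      qed
      moreover have "err \<pi> \<subseteq> space (coins A)" by (auto simp: err_def error_event_def)
      moreover have "space (coins B) = UNIV" by (simp add: B_def)
      ultimately show ?thesis
        using result_B[OF \<open>\<pi> \<in> P\<close>] by (auto simp: error_event_def[of n p B])
    qed
    also have "prob (err \<pi>) \<le> 1 / 3"
      using that comp by (simp add: computes_perm_sgn_def err_def P_def)
    finally show ?thesis .
  qed
  then have "computes_perm_sgn n p B"
    by (simp add: computes_perm_sgn_def P_def B_def)
  with B_space show ?thesis by blast
qed

section \<open>Runs cut at the segment ends\<close>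

text \<open>The start state is an argument, so that a segment can be run from a guessed
  state.\<close>

primrec run_from ::
    "('q, 'r, 'o) streaming_alg \<Rightarrow> (nat \<Rightarrow> nat) \<Rightarrow> (nat \<Rightarrow> 'r) \<Rightarrow> nat \<Rightarrow> 'q \<Rightarrow> nat \<Rightarrow> 'q" where
  "run_from A x \<rho> t q 0 = q"
| "run_from A x \<rho> t q (Suc m) = update A (run_from A x \<rho> t q m) (x (Suc (t + m))) (\<rho> (Suc (t + m)))"

lemma state_at_add: "state_at A x \<rho> (t + m) = run_from A x \<rho> t (state_at A x \<rho> t) m"
  by (induction m) auto

lemma run_from_cong:
  assumes "\<And>i. t < i \<Longrightarrow> i \<le> t + m \<Longrightarrow> x i = x' i"
  shows "run_from A x \<rho> t q m = run_from A x' \<rho> t q m"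
  using assms by (induction m) auto

text \<open>
  The time after j segments; the last segment of each pass contains the tail.
\<close>

definition boundary :: "nat \<Rightarrow> nat \<Rightarrow> nat \<Rightarrow> nat" where
  "boundary n N j = (j div 3) * n + (j mod 3) * N"

lemma boundary_Suc:
  "boundary n N (Suc j) = (if j mod 3 = 2 then Suc (j div 3) * n else boundary n N j + N)"
  by (auto simp: boundary_def mod_Suc div_Suc)

lemma boundary_mono:
  assumes "3 * N \<le> n"
  shows "boundary n N j \<le> boundary n N (Suc j)"
  using assms by (auto simp: boundary_Suc) (simp add: boundary_def)

lemma boundary_le:
  assumes "3 * N \<le> n" "j \<le> 3 * p"
  shows "boundary n N j \<le> p * n"
proof -
  have "boundary n N j \<le> boundary n N (3 * p)"
    by (rule lift_Suc_mono_le[of "boundary n N"]) (use assms boundary_mono in auto)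
  then show ?thesis by (simp add: boundary_def)
qed

text \<open>
  During a segment the algorithm cannot distinguish the input from the (usually not injective) one
  in which all three segments carry the coordinates of the current one.
\<close>

lemma input_stream_segment:
  assumes le: "3 * N \<le> n" and t: "boundary n N j < t" "t \<le> boundary n N (Suc j)"
  shows "input_stream n (block_perm N v) t = input_stream n (block_perm N (\<lambda>_. v (j mod 3))) t"
proof -
  define k a where "k = j div 3" and "a = j mod 3"
  define r where "r = t - 1 - k * n"
  have b: "boundary n N j = k * n + a * N"
    "boundary n N (Suc j) = (if a = 2 then k * n + n else k * n + a * N + N)"
    by (simp_all add: boundary_Suc k_def a_def) (simp_all add: boundary_def)
  have tr: "t = Suc (k * n + r)" using t(1) by (simp add: r_def b)
  have rlo: "a * N \<le> r" using t(1) by (simp add: tr b)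
  have a: "a = 0 \<or> a = 1 \<or> a = 2" unfolding a_def by linarith
  have rhi: "r < n" "r < 3 * N \<Longrightarrow> r < a * N + N"
    using t(2) le a by (auto simp: tr b)
  \<comment> \<open>Here r is the position within the pass, counted from 0. For r \<ge> 3 * N it
    lies in the tail, where both maps are the identity.\<close>
  have "r div N = a" if "r < 3 * N"
    using rlo rhi(2)[OF that] by (intro div_nat_eqI) (auto simp: mult.commute)
  then show ?thesis
    using rhi(1) by (auto simp: input_stream_def tr block_perm_def simp flip: a_def)
qed

section \<open>Correlation of a run with fixed coins\<close>

definition triple :: "'a \<Rightarrow> 'a \<Rightarrow> 'a \<Rightarrow> nat \<Rightarrow> 'a" where
  "triple x y z a = (if a = 0 then x else if a = 1 then y else z)"

lemma admissible_triple:
  assumes "x \<in> ternary N" "y \<in> ternary N" "z \<in> ternary N"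
    and "(\<Prod>i<N. levi_civita (x i) (y i) (z i)) \<noteq> 0"
  shows "admissible N (triple x y z)"
proof -
  have "inj_on (\<lambda>a. triple x y z a i) {..<3}" "\<forall>a<3. triple x y z a i < 3" if i: "i < N" for i
  proof -
    have "levi_civita (x i) (y i) (z i) \<noteq> 0" using assms(4) i by auto
    then have "x i \<noteq> y i" "x i \<noteq> z i" "y i \<noteq> z i" by (auto simp: levi_civita_def)
    then show "inj_on (\<lambda>a. triple x y z a i) {..<3}"
      by (auto simp: inj_on_def triple_def split: if_splits)
    show "\<forall>a<3. triple x y z a i < 3"
      using assms(1-3)[THEN PiE_mem, of i] i by (simp add: triple_def)
  qed
  then show ?thesis by (simp add: admissible_def)
qed

lemma deterministic_correlation:
  fixes A :: "('q, 'r, 'o) streaming_alg" and \<phi> :: "'q \<Rightarrow> real"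
  assumes space: "streaming_alg_with_space n s A" and le: "3 * N \<le> n"
    and \<phi>: "\<And>q. \<bar>\<phi> q\<bar> \<le> 1"
  shows "\<bar>\<Sum>x\<in>ternary N. \<Sum>y\<in>ternary N. \<Sum>z\<in>ternary N.
            (\<Prod>i<N. levi_civita (x i) (y i) (z i))
            * \<phi> (state_at A (input_stream n (block_perm N (triple x y z))) \<rho> (p * n))\<bar>
         \<le> 2 ^ (s * (3 * p + 1)) * sqrt ((162 / 5) ^ N)"
proof -
  let ?X = "ternary N" and ?Q = "states A" and ?b = "boundary n N"
  let ?in = "\<lambda>v. input_stream n (block_perm N v)"
  define E where "E x y z = (\<Prod>i<N. levi_civita (x i) (y i) (z i))" for x y z :: "nat \<Rightarrow> nat"
  \<comment> \<open>Guessed transcripts of the states at the segment ends. The fixed start state is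
    counted as well, whence the exponent \<open>3 * p + 1\<close>.\<close>
  define T where "T = {\<sigma> \<in> {..3 * p} \<rightarrow>\<^sub>E ?Q. \<sigma> 0 = initial A}"
  \<comment> \<open>Each segment is checked from its own guessed state on an input built from x
    alone. Hence acceptance of a transcript is a product condition on the three words, that is, a
    box.\<close>
  define accepts where "accepts \<sigma> j x \<longleftrightarrow>
    run_from A (?in (\<lambda>_. x)) \<rho> (?b j) (\<sigma> j) (?b (Suc j) - ?b j) = \<sigma> (Suc j)" for \<sigma> j x
  define U :: "nat \<Rightarrow> (nat \<Rightarrow> 'q) \<Rightarrow> (nat \<Rightarrow> nat) \<Rightarrow> real" where
    "U a \<sigma> x = of_bool (\<forall>j<3 * p. j mod 3 = a \<longrightarrow> accepts \<sigma> j x)" for a \<sigma> x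
  have finQ: "finite ?Q" and cardQ: "card ?Q \<le> 2 ^ s"
    using space by (auto simp: streaming_alg_with_space_def)
  have finT: "finite T" unfolding T_def using finQ by (simp add: finite_PiE)
  have "card T \<le> card ({..3 * p} \<rightarrow>\<^sub>E ?Q)"
    unfolding T_def using finQ by (intro card_mono) (auto simp: finite_PiE)
  also have "\<dots> = card ?Q ^ (3 * p + 1)" by (simp add: card_PiE)
  also have "\<dots> \<le> (2 ^ s) ^ (3 * p + 1)" using cardQ by (rule power_mono) simp
  finally have cardT: "card T \<le> 2 ^ (s * (3 * p + 1))" by (simp only: power_mult)
  have transcript: "\<phi> (state_at A (?in (triple x y z)) \<rho> (p * n))
      = (\<Sum>\<sigma>\<in>T. \<phi> (\<sigma> (3 * p)) * U 0 \<sigma> x * U 1 \<sigma> y * U 2 \<sigma> z)"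
    if adm: "admissible N (triple x y z)" for x y z
  proof -
    define S where "S j = state_at A (?in (triple x y z)) \<rho> (?b j)" for j
    define \<tau> where "\<tau> = restrict S {..3 * p}"
    \<comment> \<open>Admissibility enters here: the letters of a permutation lie in {1..n}, so the
      run stays in the finite state set.\<close>
    have SQ: "S j \<in> ?Q" if "j \<le> 3 * p" for j
      unfolding S_def using space
    proof (rule state_at_in_states)
      fix i assume "1 \<le> i" "i \<le> ?b j"
      then show "?in (triple x y z) i \<in> {1..n}"
        using boundary_le[OF le that] block_perm_permutes[OF adm le]
        by (intro inputs_in_range[where p = p]) auto
    qed
    have S_Suc: "S (Suc j) = run_from A (?in (\<lambda>_. triple x y z (j mod 3))) \<rho> (?b j) (S j) (?b (Suc j) - ?b j)"
      for j
    proof -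
      have "S (Suc j) = run_from A (?in (triple x y z)) \<rho> (?b j) (S j) (?b (Suc j) - ?b j)"
        using boundary_mono[OF le, of j] state_at_add[of A "?in (triple x y z)" \<rho> "?b j" "?b (Suc j) - ?b j"]
        by (simp add: S_def)
      also have "\<dots> = run_from A (?in (\<lambda>_. triple x y z (j mod 3))) \<rho> (?b j) (S j) (?b (Suc j) - ?b j)"
        using boundary_mono[OF le, of j]
        by (intro run_from_cong input_stream_segment[OF le]) auto
      finally show ?thesis .
    qed
    have S0: "S 0 = initial A" by (simp add: S_def boundary_def)
    have \<tau>T: "\<tau> \<in> T" using SQ S0 by (simp add: T_def \<tau>_def)
    have mod3: "(\<forall>j<3 * p. P j (j mod 3)) \<longleftrightarrow> (\<forall>a<3. \<forall>j<3 * p. j mod 3 = a \<longrightarrow> P j a)" for P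
      by auto
    have U_eq: "U 0 \<sigma> x * U 1 \<sigma> y * U 2 \<sigma> z = of_bool (\<sigma> = \<tau>)" if \<sigma>: "\<sigma> \<in> T" for \<sigma>
    proof -
      have all3: "(\<forall>a<3::nat. P a) \<longleftrightarrow> P 0 \<and> P 1 \<and> P 2" for P
        using less_3_cases by auto
      have "U 0 \<sigma> x * U 1 \<sigma> y * U 2 \<sigma> z = of_bool (\<forall>j<3 * p. accepts \<sigma> j (triple x y z (j mod 3)))"
        unfolding mod3[of "\<lambda>j a. accepts \<sigma> j (triple x y z a)"] all3 U_def
        by (simp add: triple_def)
      also have "(\<forall>j<3 * p. accepts \<sigma> j (triple x y z (j mod 3))) \<longleftrightarrow> \<sigma> = \<tau>"
      proof
        assume acc: "\<forall>j<3 * p. accepts \<sigma> j (triple x y z (j mod 3))"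
        have "\<sigma> j = S j" if "j \<le> 3 * p" for j
          using that
        proof (induction j)
          case 0
          then show ?case using \<sigma> S0 by (simp add: T_def)
        next
          case (Suc j)
          then have "accepts \<sigma> j (triple x y z (j mod 3))" using acc by simp
          then show ?case using Suc S_Suc[of j] by (simp add: accepts_def)
        qed
        then show "\<sigma> = \<tau>"
          using \<sigma> \<tau>T by (intro PiE_ext[of \<sigma> "{..3 * p}" "\<lambda>_. ?Q" \<tau>]) (auto simp: T_def \<tau>_def)
      next
        assume "\<sigma> = \<tau>"
        then show "\<forall>j<3 * p. accepts \<sigma> j (triple x y z (j mod 3))"
          using S_Suc by (simp add: accepts_def \<tau>_def)
      qed
      finally show ?thesis .
    qed
    have "(\<Sum>\<sigma>\<in>T. \<phi> (\<sigma> (3 * p)) * U 0 \<sigma> x * U 1 \<sigma> y * U 2 \<sigma> z)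
        = (\<Sum>\<sigma>\<in>T. if \<sigma> = \<tau> then \<phi> (\<tau> (3 * p)) else 0)"
    proof (rule sum.cong[OF refl])
      fix \<sigma> assume "\<sigma> \<in> T"
      have "\<phi> (\<sigma> (3 * p)) * U 0 \<sigma> x * U 1 \<sigma> y * U 2 \<sigma> z
          = \<phi> (\<sigma> (3 * p)) * (U 0 \<sigma> x * U 1 \<sigma> y * U 2 \<sigma> z)"
        by (simp only: mult.assoc)
      also have "\<dots> = (if \<sigma> = \<tau> then \<phi> (\<tau> (3 * p)) else 0)"
        unfolding U_eq[OF \<open>\<sigma> \<in> T\<close>] by simp
      finally show "\<phi> (\<sigma> (3 * p)) * U 0 \<sigma> x * U 1 \<sigma> y * U 2 \<sigma> z
          = (if \<sigma> = \<tau> then \<phi> (\<tau> (3 * p)) else 0)" .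
    qed
    also have "\<dots> = \<phi> (S (3 * p))" using finT \<tau>T by (simp add: \<tau>_def)
    finally show ?thesis by (simp add: S_def boundary_def)
  qed
  have "(\<Sum>x\<in>?X. \<Sum>y\<in>?X. \<Sum>z\<in>?X. E x y z * \<phi> (state_at A (?in (triple x y z)) \<rho> (p * n)))
      = (\<Sum>x\<in>?X. \<Sum>y\<in>?X. \<Sum>z\<in>?X. \<Sum>\<sigma>\<in>T. E x y z * (\<phi> (\<sigma> (3 * p)) * U 0 \<sigma> x * U 1 \<sigma> y * U 2 \<sigma> z))"
  proof (intro sum.cong[OF refl])
    fix x y z assume xyz: "x \<in> ?X" "y \<in> ?X" "z \<in> ?X"
    show "E x y z * \<phi> (state_at A (?in (triple x y z)) \<rho> (p * n))
        = (\<Sum>\<sigma>\<in>T. E x y z * (\<phi> (\<sigma> (3 * p)) * U 0 \<sigma> x * U 1 \<sigma> y * U 2 \<sigma> z))"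
    \<comment> \<open>The transcript formula is available for admissible triples only; a nonzero
      coefficient guarantees admissibility.\<close>
    proof (cases "E x y z = 0")
      case False
      then show ?thesis
        using transcript[OF admissible_triple[OF xyz]] by (simp add: E_def sum_distrib_left)
    qed simp
  qed
  also have "\<dots> = (\<Sum>\<sigma>\<in>T. \<Sum>x\<in>?X. \<Sum>y\<in>?X. \<Sum>z\<in>?X.
      E x y z * (\<phi> (\<sigma> (3 * p)) * U 0 \<sigma> x * U 1 \<sigma> y * U 2 \<sigma> z))" (is "_ = (\<Sum>\<sigma>\<in>T. ?S \<sigma>)")
    by (rule sym, rule trans[OF sum.swap], rule sum.cong[OF refl], rule trans[OF sum.swap],
        rule sum.cong[OF refl], rule sum.swap)
  finally have eq: "(\<Sum>x\<in>?X. \<Sum>y\<in>?X. \<Sum>z\<in>?X.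
      E x y z * \<phi> (state_at A (?in (triple x y z)) \<rho> (p * n))) = (\<Sum>\<sigma>\<in>T. ?S \<sigma>)" .
  have "\<bar>\<Sum>\<sigma>\<in>T. ?S \<sigma>\<bar> \<le> (\<Sum>\<sigma>\<in>T. \<bar>?S \<sigma>\<bar>)" by (rule sum_abs)
  also have "\<dots> \<le> (\<Sum>\<sigma>\<in>T. sqrt ((162 / 5) ^ N))"
  proof (rule sum_mono)
    fix \<sigma>
    have "(?S \<sigma>)\<^sup>2 \<le> (162 / 5) ^ N"
      unfolding E_def
    \<comment> \<open>The output weight is constant on the box of \<sigma> and is absorbed into the
      factor for x.\<close>
    proof (rule levi_civita_discrepancy[where u = "\<lambda>x. \<phi> (\<sigma> (3 * p)) * U 0 \<sigma> x"])
      show "\<bar>\<phi> (\<sigma> (3 * p)) * U 0 \<sigma> x\<bar> \<le> 1" for x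
        using \<phi> by (simp add: U_def)
    qed (simp_all add: U_def)
    then show "\<bar>?S \<sigma>\<bar> \<le> sqrt ((162 / 5) ^ N)"
      by (simp add: real_le_rsqrt)
  qed
  also have "\<dots> = card T * sqrt ((162 / 5) ^ N)" by simp
  also have "\<dots> \<le> 2 ^ (s * (3 * p + 1)) * sqrt ((162 / 5) ^ N)"
  proof (rule mult_right_mono)
    have "real (card T) \<le> real (2 ^ (s * (3 * p + 1)))" using cardT by (rule of_nat_mono)
    then show "real (card T) \<le> 2 ^ (s * (3 * p + 1))" by (simp only: of_nat_power of_nat_numeral)
  qed simp
  finally show ?thesis unfolding eq[unfolded E_def] E_def .
qed

section \<open>Averaging over the coins\<close>

lemma sum_abs_levi_civita:
  "(\<Sum>x\<in>ternary N. \<Sum>y\<in>ternary N. \<Sum>z\<in>ternary N. \<bar>\<Prod>i<N. levi_civita (x i) (y i) (z i)\<bar>) = 6 ^ N"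
proof -
  have "(\<Sum>x\<in>ternary N. \<Sum>y\<in>ternary N. \<Sum>z\<in>ternary N. \<bar>\<Prod>i<N. levi_civita (x i) (y i) (z i)\<bar>)
      = (\<Sum>x\<in>ternary N. \<Sum>y\<in>ternary N. \<Prod>i<N. \<Sum>c<3. \<bar>levi_civita (x i) (y i) c\<bar>)"
    by (simp add: prod_sum_PiE abs_prod)
  also have "\<dots> = (\<Prod>i<N. \<Sum>a<3. \<Sum>b<3. \<Sum>c<3. \<bar>levi_civita a b c\<bar>)"
    by (rule sum_PiE2) simp_all
  also have "(\<Sum>a<3. \<Sum>b<3. \<Sum>c<3. \<bar>levi_civita a b c\<bar>) = 6"
    by (simp add: sum_lessThan_3 levi_civita_def)
  finally show ?thesis by simp
qed

lemma abs_levi_civita: "levi_civita a b c \<noteq> 0 \<Longrightarrow> \<bar>levi_civita a b c\<bar> = 1"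
  by (auto simp: levi_civita_def abs_mult abs_sgn_eq)

text \<open>For each sample, right answers exceed wrong ones on the inputs \<open>H\<close> by at
  most the correlation bound. Error at most 1/3 forces an expected excess of at least 1/3 for each
  of the 6 ^ N inputs.\<close>

lemma streaming_discrepancy_bound:
  fixes A :: "('q, 'r, 'o) streaming_alg"
  assumes space: "streaming_alg_with_space n s A" and comp: "computes_perm_sgn n p A"
    and le: "3 * N \<le> n"
  shows "6 ^ N / 3 \<le> 2 ^ (s * (3 * p + 1)) * sqrt ((162 / 5) ^ N)"
proof -
  interpret prob_space "coins A" using space by (simp add: streaming_alg_with_space_def)
  let ?X = "ternary N"
  let ?B = "2 ^ (s * (3 * p + 1)) * sqrt ((162 / 5) ^ N) :: real"
  define E where "E = (\<lambda>(x, y, z). \<Prod>i<N. levi_civita (x i) (y i) (z i))"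
  define H where "H = {h \<in> ?X \<times> ?X \<times> ?X. E h \<noteq> 0}"
  define \<pi> where "\<pi> = (\<lambda>(x, y, z). block_perm N (triple x y z))"
  define K where "K = real_of_int (block_sign N)"
  have fin3: "finite (?X \<times> ?X \<times> ?X)" by (simp add: finite_ternary)
  have absK: "\<bar>K\<bar> = 1" by (simp add: K_def block_sign_def)
  have absE: "\<bar>E h\<bar> = 1" if "h \<in> H" for h
  proof -
    obtain x y z where h: "h = (x, y, z)" by (cases h)
    then have "(\<Prod>i<N. levi_civita (x i) (y i) (z i)) \<noteq> 0"
      using that by (simp add: H_def E_def)
    then have "levi_civita (x i) (y i) (z i) \<noteq> 0" if "i < N" for i
      using that by simp
    then show ?thesis by (simp add: h E_def abs_prod abs_levi_civita)
  qed
  have adm: "admissible N (triple x y z)" if "(x, y, z) \<in> H" for x y z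
    using that by (intro admissible_triple) (simp_all add: H_def E_def)
  have perm: "\<pi> h permutes {1..n}" if "h \<in> H" for h
    using that block_perm_permutes[OF adm le] by (cases h) (simp add: \<pi>_def del: One_nat_def)
  have sgn: "real_of_int (perm_sgn n (\<pi> h)) = K * E h" if "h \<in> H" for h
    using that by (cases h) (simp add: \<pi>_def K_def E_def triple_def perm_sgn_block_perm[OF adm le])
  have err: "error_event n p A (\<pi> h) \<in> events" "prob (error_event n p A (\<pi> h)) \<le> 1 / 3"
    if "h \<in> H" for h
    using comp perm[OF that] by (auto simp: computes_perm_sgn_def)
  have "real (card H) = (\<Sum>h\<in>H. \<bar>E h\<bar>)" by (simp add: absE)
  also have "\<dots> = (\<Sum>h\<in>?X \<times> ?X \<times> ?X. \<bar>E h\<bar>)"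
    using fin3 by (intro sum.mono_neutral_left) (auto simp: H_def)
  also have "\<dots> = 6 ^ N"
    using sum_abs_levi_civita[of N] by (simp add: sum.cartesian_product' E_def)
  finally have cardH: "real (card H) = 6 ^ N" .
  have pointwise: "(\<Sum>h\<in>H. 1 - 2 * indicator (error_event n p A (\<pi> h)) \<omega>) \<le> ?B"
    if \<omega>: "\<omega> \<in> space (coins A)" for \<omega>
  proof -
    \<comment> \<open>Every output other than 1 is read as -1. A wrong output may thereby count as
      right, which only increases the correlation; hence an inequality below.\<close>
    define \<phi> :: "'q \<Rightarrow> real" where "\<phi> q = (if result A q (snd \<omega>) = 1 then 1 else - 1)" for q
    define S where "S h = state_at A (input_stream n (\<pi> h)) (fst \<omega>) (p * n)" for h
    have "(\<Sum>h\<in>H. 1 - 2 * indicator (error_event n p A (\<pi> h)) \<omega>) \<le> (\<Sum>h\<in>H. K * (E h * \<phi> (S h)))"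
    proof (rule sum_mono)
      fix h assume h: "h \<in> H"
      have KE: "K * E h = 1 \<or> K * E h = - 1"
        using absE[OF h] absK by (auto simp: abs_if split: if_splits)
      show "1 - 2 * indicator (error_event n p A (\<pi> h)) \<omega> \<le> K * (E h * \<phi> (S h))"
      proof (cases "\<omega> \<in> error_event n p A (\<pi> h)")
        case True
        then show ?thesis using KE by (auto simp: \<phi>_def)
      next
        case False
        then have "result A (S h) (snd \<omega>) = perm_sgn n (\<pi> h)"
          using \<omega> by (simp add: error_event_def run_result_def S_def)
        then have "\<phi> (S h) = K * E h"
          using KE sgn[OF h] by (auto simp: \<phi>_def)
        then show ?thesis using KE False by auto
      qed
    qed
    also have "\<dots> = K * (\<Sum>h\<in>H. E h * \<phi> (S h))" by (simp add: sum_distrib_left)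
    also have "\<dots> \<le> \<bar>\<Sum>h\<in>H. E h * \<phi> (S h)\<bar>"
      using absK by (auto simp: abs_if split: if_splits)
    also have "(\<Sum>h\<in>H. E h * \<phi> (S h)) = (\<Sum>h\<in>?X \<times> ?X \<times> ?X. E h * \<phi> (S h))"
      using fin3 by (intro sum.mono_neutral_left) (auto simp: H_def)
    also have "\<bar>\<dots>\<bar> \<le> ?B"
      using deterministic_correlation[OF space le, of \<phi> "fst \<omega>" p]
      by (simp add: sum.cartesian_product' E_def S_def \<pi>_def \<phi>_def)
    finally show ?thesis .
  qed
  have ind: "integrable (coins A) (indicator (error_event n p A (\<pi> h)) :: _ \<Rightarrow> real)" if "h \<in> H" for h
    using err(1)[OF that] by (simp add: less_top[symmetric])
  have "6 ^ N / 3 = (\<Sum>h\<in>H. 1 - 2 * (1 / 3 :: real))" by (simp add: cardH)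
  also have "\<dots> \<le> (\<Sum>h\<in>H. 1 - 2 * prob (error_event n p A (\<pi> h)))"
  proof (rule sum_mono)
    fix h assume "h \<in> H"
    then show "1 - 2 * (1 / 3) \<le> 1 - 2 * prob (error_event n p A (\<pi> h))"
      using err(2)[of h] by linarith
  qed
  also have "\<dots> = (\<Sum>h\<in>H. expectation (\<lambda>\<omega>. 1 - 2 * indicator (error_event n p A (\<pi> h)) \<omega>))"
    using ind err(1) by (intro sum.cong[OF refl]) (simp add: prob_space)
  also have "\<dots> = expectation (\<lambda>\<omega>. \<Sum>h\<in>H. 1 - 2 * indicator (error_event n p A (\<pi> h)) \<omega>)"
    using ind by (subst Bochner_Integration.integral_sum) auto
  also have "\<dots> \<le> ?B"
    using ind pointwise by (intro integral_le_const Bochner_Integration.integrable_sum) auto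
  finally show ?thesis .
qed

section \<open>Choice of the constants\<close>

lemma space_lower_bound:
  fixes A :: "('q, 'r, 'o) streaming_alg"
  assumes space: "streaming_alg_with_space n s A" and comp: "computes_perm_sgn n p A"
    and p: "p \<ge> 1" and n: "n \<ge> 210"
  shows "real s \<ge> 1 / 336 * real n / real p"
proof -
  \<comment> \<open>The gain per coordinate is 36 / (162/5) = 10/9, and seven coordinates give a
    factor above 2. They occupy 21 positions.\<close>
  define M where "M = n div 21"
  have "6 ^ (7 * M) / 3 \<le> 2 ^ (s * (3 * p + 1)) * sqrt ((162 / 5) ^ (7 * M))"
    using space comp by (rule streaming_discrepancy_bound) (simp add: M_def)
  also have "\<dots> \<le> 2 ^ (4 * s * p) * sqrt ((162 / 5) ^ (7 * M))"
  proof -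
    have "s * (3 * p + 1) \<le> s * (4 * p)" using p by (intro mult_left_mono) auto
    then show ?thesis by (intro mult_right_mono power_increasing) (simp_all add: mult_ac)
  qed
  finally have "(6 ^ (7 * M) / 3)\<^sup>2 \<le> (2 ^ (4 * s * p) * sqrt ((162 / 5) ^ (7 * M)))\<^sup>2"
    by (rule power_mono) simp
  also have "(2 ^ (4 * s * p) * sqrt ((162 / 5) ^ (7 * M)))\<^sup>2 = 2 ^ (8 * s * p) * (162 / 5 :: real) ^ (7 * M)"
  proof -
    have "((2 :: real) ^ (4 * s * p))\<^sup>2 = 2 ^ (4 * s * p * 2)" by (rule power_mult[symmetric])
    also have "4 * s * p * 2 = 8 * s * p" by simp
    finally show ?thesis unfolding power_mult_distrib by (subst real_sqrt_pow2) simp_all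
  qed
  also have "((6 :: real) ^ (7 * M) / 3)\<^sup>2 = 36 ^ (7 * M) / 9"
  proof -
    have "((6 :: real) ^ (7 * M))\<^sup>2 = (6\<^sup>2) ^ (7 * M)"
      unfolding power_mult[symmetric] by (simp add: mult.commute)
    then show ?thesis by (simp add: power_divide)
  qed
  finally have "36 ^ (7 * M) \<le> 9 * (2 ^ (8 * s * p) * (162 / 5 :: real) ^ (7 * M))"
    by linarith
  moreover have "(36 :: real) ^ (7 * M) = (10 / 9) ^ (7 * M) * (162 / 5) ^ (7 * M)"
    by (simp flip: power_mult_distrib)
  ultimately have "(10 / 9 :: real) ^ (7 * M) * (162 / 5) ^ (7 * M) \<le> (9 * 2 ^ (8 * s * p)) * (162 / 5) ^ (7 * M)"
    by (simp add: mult_ac)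
  then have "(10 / 9 :: real) ^ (7 * M) \<le> 9 * 2 ^ (8 * s * p)"
    by (rule mult_right_le_imp_le) simp
  moreover have "(2 :: real) ^ M \<le> (10 / 9) ^ (7 * M)"
    unfolding power_mult by (rule power_mono) (simp_all add: power_divide)
  moreover have "9 * 2 ^ (8 * s * p) \<le> (2 :: real) ^ (4 + 8 * s * p)"
    by (simp add: power_add)
  ultimately have "(2 :: real) ^ M \<le> 2 ^ (4 + 8 * s * p)"
    by (meson order_trans)
  then have "M \<le> 4 + 8 * s * p" by (rule power_le_imp_le_exp[rotated]) simp
  \<comment> \<open>From n < 21 * (M + 1) follows n < 105 + 168 * s * p, and 105 is at most half of
    n because n \<ge> 210.\<close>
  then have "n \<le> 336 * (s * p)" using n unfolding M_def by linarith
  then have "real n \<le> 336 * (real s * real p)"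
    by (metis of_nat_le_iff of_nat_mult of_nat_numeral)
  then show ?thesis using p by (simp add: divide_le_eq)
qed

text \<open>Types cannot be quantified inside the existential, so the constants are found for
  algorithms over the naturals, and any constants valid there are shown to be valid for all types.
  The latter is what \<open>discrete_simulation\<close> provides.\<close>

theorem theorem1p1:
  "(\<exists>c>0. \<exists>n0. perm_sgn_space_bound TYPE((nat, nat, nat) streaming_alg) c n0) \<and>
   (\<forall>c>0. \<forall>n0. perm_sgn_space_bound TYPE((nat, nat, nat) streaming_alg) c n0 \<longrightarrow>
      perm_sgn_space_bound TYPE(('q, 'r, 'o) streaming_alg) c n0)"
proof (intro conjI allI impI)
  have "perm_sgn_space_bound TYPE((nat, nat, nat) streaming_alg) (1 / 336) 210"
    unfolding perm_sgn_space_bound_def using space_lower_bound by blast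
  then show "\<exists>c>0. \<exists>n0. perm_sgn_space_bound TYPE((nat, nat, nat) streaming_alg) c n0"
    by (intro exI[of _ "1 / 336"] conjI exI[of _ 210]) simp_all
next
  fix c :: real and n0
  assume "perm_sgn_space_bound TYPE((nat, nat, nat) streaming_alg) c n0"
  then show "perm_sgn_space_bound TYPE(('q, 'r, 'o) streaming_alg) c n0"
    unfolding perm_sgn_space_bound_def using discrete_simulation by blast
qed

end
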